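(* Let $p>1$ be an integer. Suppose that $\varphi$ is a bounded analytic function on the open unit disc $\mathbb{U}$ that is $p$-valent, that $\varphi-\varphi(z_0)$ has a zero of order $p$ at some point $z_0\in\mathbb{U}$, and that $\varphi$ singly covers some nonvoid open subset $W$ of $\varphi(\mathbb{U})$. Then there exists a bounded analytic function $\psi$ on $\mathbb{U}$ with $\psi(\mathbb{U})\subset\varphi(\mathbb{U})$ such that $T_\varphi\not\propto T_\psi$.
   Context: $\mathbb{U}$ is the open unit disc in $\mathbb{C}$ and $H^2$ is the Hardy space of $\mathbb{U}$. For a bounded analytic function $\varphi$ on $\mathbb{U}$, $T_\varphi:H^2\to H^2$ is the analytic Toeplitz operator $T_\varphi h=\varphi h$. For bounded linear operators $A,B$ on a Hilbert space $\mathcal{H}$, $A\propto B$ means that there is a nonzero bounded linear operator $X$ on $\mathcal{H}$ with $XA=BX$; $\not\propto$ is its negation. $\varphi$ is $p$-valent if it takes each value at most $p$ times in $\mathbb{U}$, counting multiplicity, and takes some value exactly $p$ times. "$\varphi$ singly covers a set $W$" means that $\varphi$ takes some set $V\subset\mathbb{U}$ univalently (injectively) onto $W$ with $\varphi^{-1}(W)=V$, where $\varphi^{-1}(W)=\{z\in\mathbb{U}:\varphi(z)\in W\}$. *)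

theory Defs
  imports "HOL-Complex_Analysis.Complex_Analysis"
begin

section \<open>The Hardy space of the unit disc\<close>

definition square_mean :: "(complex \<Rightarrow> complex) \<Rightarrow> real \<Rightarrow> real" where
  "square_mean f r = (1 / (2 * pi)) * integral {0..2 * pi} (\<lambda>t. (cmod (f (of_real r * cis t)))\<^sup>2)"

lemma circle_in_ball: "r \<in> {0..<1} \<Longrightarrow> of_real r * cis t \<in> ball 0 1"
  by (simp add: norm_mult)

lemma square_mean_integrand_continuous:
  assumes "f holomorphic_on ball 0 1" "r \<in> {0..<1}"
  shows "continuous_on S (\<lambda>t. (cmod (f (of_real r * cis t)))\<^sup>2)"
proof -
  have "continuous_on S (\<lambda>t. f (of_real r * cis t))"
    by (rule continuous_on_compose2[OF holomorphic_on_imp_continuous_on[OF assms(1)]])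
      (use circle_in_ball[OF assms(2)] in \<open>auto intro!: continuous_intros\<close>)
  then show ?thesis by (intro continuous_intros)
qed

lemma square_mean_integrand_integrable:
  assumes "f holomorphic_on ball 0 1" "r \<in> {0..<1}"
  shows "(\<lambda>t. (cmod (f (of_real r * cis t)))\<^sup>2) integrable_on {0..2 * pi}"
  by (intro integrable_continuous_real square_mean_integrand_continuous assms)

lemma square_mean_nonneg: "square_mean f r \<ge> 0"
  unfolding square_mean_def
  by (cases "(\<lambda>t. (cmod (f (of_real r * cis t)))\<^sup>2) integrable_on {0..2 * pi}")
    (auto intro!: divide_nonneg_nonneg integral_nonneg simp: not_integrable_integral)

lemma square_mean_zero [simp]: "square_mean (\<lambda>_. 0) r = 0"
  by (simp add: square_mean_def)

lemma square_mean_mult: "square_mean (\<lambda>z. c * f z) r = (cmod c)\<^sup>2 * square_mean f r"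
  by (simp add: square_mean_def norm_mult power_mult_distrib)

lemma square_mean_mono:
  assumes "f holomorphic_on ball 0 1" "g holomorphic_on ball 0 1" "r \<in> {0..<1}"
    and "\<And>z. z \<in> ball 0 1 \<Longrightarrow> cmod (f z) \<le> cmod (g z)"
  shows "square_mean f r \<le> square_mean g r"
  unfolding square_mean_def
  by (intro mult_left_mono integral_le square_mean_integrand_integrable assms power_mono
      circle_in_ball) auto

lemma square_mean_add:
  assumes "f holomorphic_on ball 0 1" "g holomorphic_on ball 0 1" "r \<in> {0..<1}" "c > 0"
  shows "square_mean (\<lambda>z. f z + g z) r \<le> (1 + c) * square_mean f r + (1 + 1 / c) * square_mean g r"
proof -
  have ineq: "(cmod (a + b))\<^sup>2 \<le> (1 + c) * (cmod a)\<^sup>2 + (1 + 1 / c) * (cmod b)\<^sup>2" for a b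
  proof -
    have "(cmod (a + b))\<^sup>2 \<le> (cmod a + cmod b)\<^sup>2"
      by (intro power_mono norm_triangle_ineq) auto
    also have "\<dots> \<le> (cmod a + cmod b)\<^sup>2 + (c * cmod a - cmod b)\<^sup>2 / c"
      using assms(4) by simp
    also have "\<dots> = (1 + c) * (cmod a)\<^sup>2 + (1 + 1 / c) * (cmod b)\<^sup>2"
      using assms(4) by (simp add: power2_eq_square field_simps)
    finally show ?thesis .
  qed
  let ?F = "\<lambda>t. (cmod (f (of_real r * cis t)))\<^sup>2"
  let ?G = "\<lambda>t. (cmod (g (of_real r * cis t)))\<^sup>2"
  have F: "?F integrable_on {0..2 * pi}" and G: "?G integrable_on {0..2 * pi}"
    by (intro square_mean_integrand_integrable assms)+
  have "integral {0..2 * pi} (\<lambda>t. (cmod (f (of_real r * cis t) + g (of_real r * cis t)))\<^sup>2)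
      \<le> integral {0..2 * pi} (\<lambda>t. (1 + c) * ?F t + (1 + 1 / c) * ?G t)"
    by (intro integral_le integrable_add integrable_on_mult_right F G ineq
        square_mean_integrand_integrable[of "\<lambda>z. f z + g z"] holomorphic_on_add assms)
  also have "\<dots> = (1 + c) * integral {0..2 * pi} ?F + (1 + 1 / c) * integral {0..2 * pi} ?G"
    using F G by (subst integral_add) (auto intro: integrable_on_mult_right)
  finally have "(1 / (2 * pi)) * integral {0..2 * pi} (\<lambda>t. (cmod (f (of_real r * cis t) + g (of_real r * cis t)))\<^sup>2)
      \<le> (1 / (2 * pi)) * ((1 + c) * integral {0..2 * pi} ?F + (1 + 1 / c) * integral {0..2 * pi} ?G)"
    by (intro mult_left_mono) auto
  then show ?thesis
    by (simp add: square_mean_def algebra_simps add_divide_distrib)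
qed

text \<open>
  Elements of the Hardy space are functions on the disc; the value \<open>0\<close> outside the disc is only a
  normalisation that makes extensional equality coincide with equality on the disc.
\<close>
typedef hardy2 =
  "{f :: complex \<Rightarrow> complex. f holomorphic_on ball 0 1 \<and>
      bdd_above (square_mean f ` {0..<1}) \<and> (\<forall>z. z \<notin> ball 0 1 \<longrightarrow> f z = 0)}"
  morphisms hfun Abs_hardy2
  by (rule exI[of _ "\<lambda>_. 0"]) auto

setup_lifting type_definition_hardy2

lemma hfun_holomorphic: "hfun f holomorphic_on ball 0 1"
  and hfun_bdd_above: "bdd_above (square_mean (hfun f) ` {0..<1})"
  and hfun_outside: "z \<notin> ball 0 1 \<Longrightarrow> hfun f z = 0"
  using hfun[of f] by auto

lemma hardy2_eqI: "(\<And>z. z \<in> ball 0 1 \<Longrightarrow> hfun f z = hfun g z) \<Longrightarrow> f = g"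
  by (metis hfun_inject hfun_outside ext)

lemma bdd_above_square_mean_add:
  assumes "f holomorphic_on ball 0 1" "g holomorphic_on ball 0 1"
    and "bdd_above (square_mean f ` {0..<1})" "bdd_above (square_mean g ` {0..<1})"
  shows "bdd_above (square_mean (\<lambda>z. f z + g z) ` {0..<1})"
proof -
  obtain A B where A: "\<And>r. r \<in> {0..<1} \<Longrightarrow> square_mean f r \<le> A"
    and B: "\<And>r. r \<in> {0..<1} \<Longrightarrow> square_mean g r \<le> B"
    using assms(3,4) unfolding bdd_above_def by blast
  have "square_mean (\<lambda>z. f z + g z) r \<le> 2 * A + 2 * B" if "r \<in> {0..<1}" for r
    using square_mean_add[OF assms(1,2) that, of 1] A[OF that] B[OF that] by simp
  then show ?thesis by (intro bdd_aboveI2)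
qed

lemma bdd_above_square_mean_mult:
  assumes "bdd_above (square_mean f ` {0..<1})"
  shows "bdd_above (square_mean (\<lambda>z. c * f z) ` {0..<1})"
proof -
  obtain A where A: "\<And>r. r \<in> {0..<1} \<Longrightarrow> square_mean f r \<le> A"
    using assms unfolding bdd_above_def by blast
  show ?thesis
    by (rule bdd_aboveI2[where M = "(cmod c)\<^sup>2 * A"])
      (auto simp: square_mean_mult intro!: mult_left_mono A)
qed

lift_definition hscale :: "complex \<Rightarrow> hardy2 \<Rightarrow> hardy2" is "\<lambda>c f z. c * f z"
  by (auto intro!: holomorphic_intros bdd_above_square_mean_mult)

instantiation hardy2 :: real_normed_vector
begin

lift_definition zero_hardy2 :: hardy2 is "\<lambda>_. 0"
  by auto

lift_definition plus_hardy2 :: "hardy2 \<Rightarrow> hardy2 \<Rightarrow> hardy2" is "\<lambda>f g z. f z + g z"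
  by (auto intro!: holomorphic_intros bdd_above_square_mean_add)

lift_definition uminus_hardy2 :: "hardy2 \<Rightarrow> hardy2" is "\<lambda>f z. - f z"
  using bdd_above_square_mean_mult[of _ "-1"] by (auto intro!: holomorphic_intros)

definition minus_hardy2 :: "hardy2 \<Rightarrow> hardy2 \<Rightarrow> hardy2" where
  "minus_hardy2 f g = f + - g"

definition scaleR_hardy2 :: "real \<Rightarrow> hardy2 \<Rightarrow> hardy2" where
  "scaleR_hardy2 a f = hscale (of_real a) f"

definition norm_hardy2 :: "hardy2 \<Rightarrow> real" where
  "norm_hardy2 f = sqrt (SUP r\<in>{0..<1}. square_mean (hfun f) r)"

definition sgn_hardy2 :: "hardy2 \<Rightarrow> hardy2" where
  "sgn_hardy2 f = inverse (norm f) *\<^sub>R f"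

definition dist_hardy2 :: "hardy2 \<Rightarrow> hardy2 \<Rightarrow> real" where
  "dist_hardy2 f g = norm (f - g)"

definition uniformity_hardy2 :: "(hardy2 \<times> hardy2) filter" where
  "uniformity_hardy2 = (INF e\<in>{0<..}. principal {(x, y). dist x y < e})"

definition open_hardy2 :: "hardy2 set \<Rightarrow> bool" where
  "open_hardy2 U \<longleftrightarrow> (\<forall>x\<in>U. eventually (\<lambda>(x', y). x' = x \<longrightarrow> y \<in> U) uniformity)"

lemma square_mean_le_norm: "r \<in> {0..<1} \<Longrightarrow> square_mean (hfun f) r \<le> (norm f)\<^sup>2"
proof -
  assume r: "r \<in> {0..<1}"
  have "square_mean (hfun f) r \<le> (SUP r\<in>{0..<1}. square_mean (hfun f) r)"
    by (intro cSUP_upper r hfun_bdd_above)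
  moreover have "0 \<le> square_mean (hfun f) r"
    by (rule square_mean_nonneg)
  ultimately show ?thesis
    by (simp add: norm_hardy2_def)
qed

lemma norm_hardy2_nonneg: "0 \<le> norm (f :: hardy2)"
proof -
  have "0 \<le> square_mean (hfun f) 0"
    by (rule square_mean_nonneg)
  also have "\<dots> \<le> (SUP r\<in>{0..<1}. square_mean (hfun f) r)"
    by (intro cSUP_upper hfun_bdd_above) auto
  finally show ?thesis
    by (simp add: norm_hardy2_def)
qed

lemma norm_hardy2_leI:
  assumes "0 \<le> C" "\<And>r. r \<in> {0..<1} \<Longrightarrow> square_mean (hfun f) r \<le> C\<^sup>2"
  shows "norm f \<le> C"
proof -
  have "(SUP r\<in>{0..<1}. square_mean (hfun f) r) \<le> C\<^sup>2"
    by (intro cSUP_least assms) auto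
  then show ?thesis
    unfolding norm_hardy2_def using assms(1) by (simp add: real_le_lsqrt)
qed

lemma hfun_zero: "hfun 0 = (\<lambda>_. 0)"
  by transfer simp

lemma hfun_plus: "hfun (f + g) = (\<lambda>z. hfun f z + hfun g z)"
  by transfer simp

lemma norm_hardy2_eq_0:
  assumes "norm (f :: hardy2) = 0"
  shows "f = 0"
proof (rule hardy2_eqI)
  fix z :: complex assume z: "z \<in> ball 0 1"
  define r where "r = cmod z"
  have r: "r \<in> {0..<1}" using z by (simp add: r_def)
  have "square_mean (hfun f) r = 0"
    using square_mean_le_norm[OF r, of f] assms square_mean_nonneg[of "hfun f" r] by simp
  then have "integral {0..2 * pi} (\<lambda>t. (cmod (hfun f (of_real r * cis t)))\<^sup>2) = 0"
    by (simp add: square_mean_def)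
  then have *: "\<forall>t\<in>{0..2 * pi}. (cmod (hfun f (of_real r * cis t)))\<^sup>2 = 0"
    by (subst (asm) integral_eq_0_iff)
      (auto intro!: square_mean_integrand_continuous hfun_holomorphic simp: r[simplified])
  have "Arg2pi z \<in> {0..2 * pi}"
    using Arg2pi_ge_0[of z] Arg2pi_lt_2pi[of z] by simp
  moreover have "of_real r * cis (Arg2pi z) = z"
    by (simp add: r_def cis_conv_exp flip: Arg2pi_eq)
  ultimately show "hfun f z = hfun 0 z"
    using *[rule_format, of "Arg2pi z"] by (simp add: hfun_zero)
qed

lemma hfun_hscale: "hfun (hscale c f) = (\<lambda>z. c * hfun f z)"
  by transfer simp

lemma norm_hscale: "norm (hscale c f) = cmod c * norm f"
proof -
  have le: "norm (hscale c f) \<le> cmod c * norm f" for c f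
    by (rule norm_hardy2_leI)
      (auto intro!: mult_left_mono mult_nonneg_nonneg norm_hardy2_nonneg square_mean_le_norm
        simp: hfun_hscale square_mean_mult power_mult_distrib)
  show ?thesis
  proof (cases "c = 0")
    case True
    then show ?thesis using le[of c f] norm_hardy2_nonneg[of "hscale c f"] by simp
  next
    case False
    have "hscale (inverse c) (hscale c f) = f"
      by (rule hardy2_eqI) (simp add: hfun_hscale False)
    then have "norm f \<le> cmod (inverse c) * norm (hscale c f)"
      using le[of "inverse c" "hscale c f"] by simp
    then have "cmod c * norm f \<le> norm (hscale c f)"
      using False by (simp add: norm_inverse norm_divide field_simps)
    then show ?thesis using le[of c f] by simp
  qed
qed

lemma norm_hardy2_triangle: "norm (f + g) \<le> norm f + norm (g :: hardy2)"
proof (cases "norm f = 0 \<or> norm g = 0")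
  case True
  then have "f = 0 \<or> g = 0" using norm_hardy2_eq_0 by auto
  moreover have "0 + g = g" "f + 0 = f"
    by (auto intro!: hardy2_eqI simp: hfun_plus hfun_zero)
  ultimately show ?thesis
    using norm_hardy2_nonneg[of f] norm_hardy2_nonneg[of g] by auto
next
  case False
  then have pos: "norm f > 0" "norm g > 0"
    using norm_hardy2_nonneg[of f] norm_hardy2_nonneg[of g] by auto
  show ?thesis
  proof (rule norm_hardy2_leI)
    fix r :: real assume r: "r \<in> {0..<1}"
    let ?c = "norm g / norm f"
    have c: "?c > 0" using pos by simp
    have "square_mean (hfun (f + g)) r
        \<le> (1 + ?c) * square_mean (hfun f) r + (1 + 1 / ?c) * square_mean (hfun g) r"
      unfolding hfun_plus by (intro square_mean_add hfun_holomorphic r c)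
    also have "\<dots> \<le> (1 + ?c) * (norm f)\<^sup>2 + (1 + 1 / ?c) * (norm g)\<^sup>2"
      using pos by (intro add_mono mult_left_mono square_mean_le_norm r) auto
    also have "\<dots> = (norm f + norm g)\<^sup>2"
      using pos by (simp add: power2_eq_square field_simps)
    finally show "square_mean (hfun (f + g)) r \<le> (norm f + norm g)\<^sup>2" .
  qed (use pos in simp)
qed

instance
proof
  fix f g h :: hardy2 and a b :: real and U :: "hardy2 set"
  show "f + g + h = f + (g + h)" by transfer (simp add: add.assoc)
  show "f + g = g + f" by transfer (simp add: add.commute)
  show "0 + f = f" by transfer simp
  show "- f + f = 0" by transfer simp
  show "f - g = f + - g" by (rule minus_hardy2_def)
  show "a *\<^sub>R (f + g) = a *\<^sub>R f + a *\<^sub>R g"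
    unfolding scaleR_hardy2_def by transfer (simp add: algebra_simps)
  show "(a + b) *\<^sub>R f = a *\<^sub>R f + b *\<^sub>R f"
    unfolding scaleR_hardy2_def by transfer (simp add: algebra_simps)
  show "a *\<^sub>R b *\<^sub>R f = (a * b) *\<^sub>R f"
    unfolding scaleR_hardy2_def by transfer (simp add: algebra_simps)
  show "1 *\<^sub>R f = f"
    unfolding scaleR_hardy2_def by transfer simp
  show "sgn f = inverse (norm f) *\<^sub>R f" by (rule sgn_hardy2_def)
  show "dist f g = norm (f - g)" by (rule dist_hardy2_def)
  show "uniformity = (INF e\<in>{0<..}. principal {(x, y). dist x (y :: hardy2) < e})"
    by (rule uniformity_hardy2_def)
  show "open U \<longleftrightarrow> (\<forall>x\<in>U. eventually (\<lambda>(x', y). x' = x \<longrightarrow> y \<in> U) uniformity)"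
    by (rule open_hardy2_def)
  have "norm (0 :: hardy2) = 0"
    by (simp add: norm_hardy2_def hfun_zero)
  then show "norm f = 0 \<longleftrightarrow> f = 0" using norm_hardy2_eq_0 by auto
  show "norm (f + g) \<le> norm f + norm g" by (rule norm_hardy2_triangle)
  show "norm (a *\<^sub>R f) = \<bar>a\<bar> * norm f" by (simp add: scaleR_hardy2_def norm_hscale)
qed

end

section \<open>Analytic Toeplitz operators and intertwining\<close>

definition bounded_analytic :: "(complex \<Rightarrow> complex) \<Rightarrow> bool" where
  "bounded_analytic \<phi> \<longleftrightarrow> \<phi> holomorphic_on ball 0 1 \<and> bounded (\<phi> ` ball 0 1)"

definition toeplitz :: "(complex \<Rightarrow> complex) \<Rightarrow> hardy2 \<Rightarrow> hardy2" where
  "toeplitz \<phi> h = Abs_hardy2 (\<lambda>z. if z \<in> ball 0 1 then \<phi> z * hfun h z else 0)"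

lemma hfun_toeplitz:
  assumes "bounded_analytic \<phi>"
  shows "hfun (toeplitz \<phi> h) = (\<lambda>z. if z \<in> ball 0 1 then \<phi> z * hfun h z else 0)"
    (is "_ = ?g")
proof -
  have \<phi>: "\<phi> holomorphic_on ball 0 1" "bounded (\<phi> ` ball 0 1)"
    using assms by (auto simp: bounded_analytic_def)
  obtain C where C: "\<And>z. z \<in> ball 0 1 \<Longrightarrow> cmod (\<phi> z) \<le> C"
    using \<phi>(2) unfolding bounded_iff by blast
  have hol: "?g holomorphic_on ball 0 1"
    by (rule holomorphic_transform[of "\<lambda>z. \<phi> z * hfun h z"])
      (auto intro!: holomorphic_intros \<phi> hfun_holomorphic)
  have "square_mean ?g r \<le> square_mean (\<lambda>z. of_real C * hfun h z) r" if "r \<in> {0..<1}" for r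
  proof (rule square_mean_mono[OF hol _ that])
    show "cmod (?g z) \<le> cmod (of_real C * hfun h z)" if "z \<in> ball 0 1" for z
      using C[OF that] that by (auto simp: norm_mult intro!: mult_right_mono)
  qed (auto intro!: holomorphic_intros hfun_holomorphic)
  then have "square_mean ?g r \<le> (cmod (of_real C))\<^sup>2 * (norm h)\<^sup>2" if "r \<in> {0..<1}" for r
    using that square_mean_le_norm[OF that, of h] unfolding square_mean_mult
    by (meson order_trans mult_left_mono zero_le_power2)
  then have "bdd_above (square_mean ?g ` {0..<1})"
    by (intro bdd_aboveI2)
  with hol show ?thesis
    unfolding toeplitz_def by (subst Abs_hardy2_inverse) auto
qed

lemma bounded_linear_toeplitz:
  assumes "bounded_analytic \<phi>"
  shows "bounded_linear (toeplitz \<phi>)"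
    and "toeplitz \<phi> (hscale c h) = hscale c (toeplitz \<phi> h)"
proof -
  have scale: "toeplitz \<phi> (hscale c h) = hscale c (toeplitz \<phi> h)" for c h
    by (rule hardy2_eqI) (simp add: hfun_toeplitz[OF assms] hfun_hscale)
  then show "toeplitz \<phi> (hscale c h) = hscale c (toeplitz \<phi> h)" .
  obtain C where C: "\<And>z. z \<in> ball 0 1 \<Longrightarrow> cmod (\<phi> z) \<le> C"
    using assms unfolding bounded_analytic_def bounded_iff by blast
  have "0 \<le> C" using order_trans[OF norm_ge_zero C[of 0]] by simp
  show "bounded_linear (toeplitz \<phi>)"
  proof (rule bounded_linear_intro)
    show "toeplitz \<phi> (f + g) = toeplitz \<phi> f + toeplitz \<phi> g" for f g
      by (rule hardy2_eqI) (simp add: hfun_toeplitz[OF assms] hfun_plus algebra_simps)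
    show "toeplitz \<phi> (a *\<^sub>R f) = a *\<^sub>R toeplitz \<phi> f" for a f
      by (simp add: scaleR_hardy2_def scale)
    show "norm (toeplitz \<phi> h) \<le> norm h * C" for h
    proof (rule norm_hardy2_leI)
      fix r :: real assume r: "r \<in> {0..<1}"
      have "square_mean (hfun (toeplitz \<phi> h)) r \<le> square_mean (\<lambda>z. of_real C * hfun h z) r"
      proof (rule square_mean_mono[OF hfun_holomorphic _ r])
        show "cmod (hfun (toeplitz \<phi> h) z) \<le> cmod (of_real C * hfun h z)" if "z \<in> ball 0 1" for z
          using C[OF that] that \<open>0 \<le> C\<close>
          by (auto simp: hfun_toeplitz[OF assms] norm_mult intro!: mult_right_mono)
      qed (auto intro!: holomorphic_intros hfun_holomorphic)
      also have "\<dots> \<le> C\<^sup>2 * (norm h)\<^sup>2"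
        unfolding square_mean_mult
        by (simp add: mult_left_mono square_mean_le_norm[OF r])
      finally show "square_mean (hfun (toeplitz \<phi> h)) r \<le> (norm h * C)\<^sup>2"
        by (simp add: power_mult_distrib mult.commute)
    qed (simp add: \<open>0 \<le> C\<close>)
  qed
qed

text \<open>
  \<open>bounded_linear\<close> is only real linearity with a norm bound, so complex homogeneity is a separate
  requirement on \<open>X\<close>.
\<close>
definition intertwined :: "(hardy2 \<Rightarrow> hardy2) \<Rightarrow> (hardy2 \<Rightarrow> hardy2) \<Rightarrow> bool"
    (infix "\<propto>" 50) where
  "A \<propto> B \<longleftrightarrow> (\<exists>X. bounded_linear X \<and> (\<forall>c h. X (hscale c h) = hscale c (X h)) \<and>
      X \<noteq> (\<lambda>_. 0) \<and> X \<circ> A = B \<circ> X)"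

section \<open>Valence and single covering\<close>

text \<open>
  \<open>zorder\<close> is the multiplicity of a zero only for functions that do not vanish identically. The
  finiteness condition in \<open>valent\<close> excludes constant \<open>\<phi>\<close>, which take their value infinitely often.
\<close>
definition times_taken :: "(complex \<Rightarrow> complex) \<Rightarrow> complex \<Rightarrow> nat" where
  "times_taken \<phi> c = (\<Sum>z\<in>{z \<in> ball 0 1. \<phi> z = c}. nat (zorder (\<lambda>w. \<phi> w - c) z))"

definition valent :: "nat \<Rightarrow> (complex \<Rightarrow> complex) \<Rightarrow> bool" where
  "valent p \<phi> \<longleftrightarrow>
     (\<forall>c. finite {z \<in> ball 0 1. \<phi> z = c} \<and> times_taken \<phi> c \<le> p) \<and> (\<exists>c. times_taken \<phi> c = p)"

definition singly_covers :: "(complex \<Rightarrow> complex) \<Rightarrow> complex set \<Rightarrow> bool" where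
  "singly_covers \<phi> W \<longleftrightarrow>
     (\<exists>V \<subseteq> ball 0 1. inj_on \<phi> V \<and> \<phi> ` V = W \<and> {z \<in> ball 0 1. \<phi> z \<in> W} = V)"

end

theory Submission
  imports Defs
begin

text \<open>
  The example rests on a rigidity property: if \<open>\<phi>\<close> singly covers \<open>W\<close>, the image of \<open>\<psi>\<close> meets \<open>W\<close> and
  \<open>T\<^sub>\<phi> \<propto> T\<^sub>\<psi>\<close>, then \<open>\<psi> = \<phi> \<circ> \<omega>\<close> for a holomorphic self-map \<open>\<omega>\<close> of the disc
  (\<open>intertwined_imp_factorization\<close>). Over \<open>W\<close> there is an inverse branch \<open>g\<close> of \<open>\<phi>\<close>, and for \<open>c \<in> W\<close>
  every function of the Hardy space that vanishes at \<open>g c\<close> is divisible by \<open>\<phi> - c\<close>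
  (\<open>singly_covered_inverse_branch\<close>). An intertwining operator \<open>X\<close> must therefore act as
  \<open>X h = X 1 \<cdot> (h \<circ> g \<circ> \<psi>)\<close> on the open set of points that \<open>\<psi>\<close> sends into \<open>W\<close>. The local map \<open>g \<circ> \<psi>\<close>
  is the quotient of \<open>X z\<close> by \<open>X 1\<close>, which continues it meromorphically to the disc; boundedness of
  \<open>X\<close> on the powers of \<open>z\<close> forces the continuation to be holomorphic with values in the disc.

  It remains to find a map \<open>\<psi>\<close> into the image of \<open>\<phi>\<close> that meets \<open>W\<close> but does not factor in this way.
  By \<open>p\<close>-valence, \<open>z\<^sub>0\<close> is the only preimage of \<open>\<phi> z\<^sub>0\<close> and is a critical point of \<open>\<phi>\<close>
  (\<open>valent_full_order\<close>), so a function \<open>\<phi> \<circ> \<omega>\<close> has vanishing derivative wherever it takes the value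
  \<open>\<phi> z\<^sub>0\<close>. Any \<open>\<psi>\<close> that takes this value with nonzero derivative and also takes a value in \<open>W\<close> is an
  example, and \<open>disc_map_through_two_points\<close> constructs one.
\<close>

section \<open>Elements of the Hardy space and point evaluations\<close>

lemma hardy2_exists:
  assumes "f holomorphic_on ball 0 1" "\<And>r. r \<in> {0..<1} \<Longrightarrow> square_mean f r \<le> B"
  obtains h where "\<And>z. z \<in> ball 0 1 \<Longrightarrow> hfun h z = f z"
proof -
  define g where "g = (\<lambda>z. if z \<in> ball 0 1 then f z else 0)"
  have hol: "g holomorphic_on ball 0 1"
    by (rule holomorphic_transform[OF assms(1)]) (simp add: g_def)
  have "g (of_real r * cis t) = f (of_real r * cis t)" if "r \<in> {0..<1}" for r t
    unfolding g_def using circle_in_ball[OF that, of t] by (rule if_P)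
  then have "square_mean g r = square_mean f r" if "r \<in> {0..<1}" for r
    using that by (simp add: square_mean_def)
  then have "bdd_above (square_mean g ` {0..<1})"
    using assms(2) by (intro bdd_aboveI2[where M = B]) auto
  with hol have "hfun (Abs_hardy2 g) = g"
    by (intro Abs_hardy2_inverse) (auto simp: g_def)
  then show thesis
    by (intro that[of "Abs_hardy2 g"]) (simp add: g_def)
qed

lemma hardy2_of_bounded:
  assumes "f holomorphic_on ball 0 1" "\<And>z. z \<in> ball 0 1 \<Longrightarrow> cmod (f z) \<le> C"
  obtains h where "\<And>z. z \<in> ball 0 1 \<Longrightarrow> hfun h z = f z" "norm h \<le> C"
proof -
  have "0 \<le> C" using order_trans[OF norm_ge_zero assms(2)[of 0]] by simp
  have le: "square_mean g r \<le> C\<^sup>2"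
    if "g holomorphic_on ball 0 1" "\<And>z. z \<in> ball 0 1 \<Longrightarrow> cmod (g z) \<le> C" "r \<in> {0..<1}" for g r
  proof -
    have "square_mean g r \<le> square_mean (\<lambda>_. of_real C) r"
      using \<open>0 \<le> C\<close> that by (intro square_mean_mono) auto
    then show ?thesis by (simp add: square_mean_def)
  qed
  obtain h where h: "\<And>z. z \<in> ball 0 1 \<Longrightarrow> hfun h z = f z"
    using hardy2_exists[OF assms(1) le[OF assms]] by blast
  moreover have "norm h \<le> C"
    using \<open>0 \<le> C\<close> by (intro norm_hardy2_leI le hfun_holomorphic) (simp_all add: h assms(2))
  ultimately show thesis by (rule that)
qed

text \<open>Cauchy's formula for the square of the function, on a circle that encloses the point, bounds
  the value at the point by the mean square over that circle.\<close>
lemma hfun_evaluation_bounded: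
  assumes "w \<in> ball 0 1"
  obtains C where "\<And>h. cmod (hfun h w) \<le> C * norm h"
proof -
  define r where "r = (1 + cmod w) / 2"
  have r: "cmod w < r" "r < 1" "0 < r" "r \<in> {0..<1}"
    using assms norm_ge_zero[of w] by (auto simp: r_def add_pos_nonneg)
  define K where "K = r / (r - cmod w)"
  have K: "K \<ge> 0" using r by (simp add: K_def)
  have "cmod (hfun h w) \<le> sqrt K * norm h" for h
  proof -
    let ?f = "hfun h"
    let ?J = "\<lambda>t. (?f (0 + r * cis t))\<^sup>2 / (0 + r * cis t - w) * r * \<i> * cis t"
    have "(\<lambda>z. (?f z)\<^sup>2) holomorphic_on cball 0 r"
      by (intro holomorphic_intros holomorphic_on_subset[OF hfun_holomorphic]) (use r in auto)
    then have "((\<lambda>u. (?f u)\<^sup>2 / (u - w)) has_contour_integral (2 * of_real pi * \<i> * (?f w)\<^sup>2))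
        (part_circlepath 0 r 0 (2 * pi))"
      using Cauchy_integral_circlepath_simple[of "\<lambda>z. (?f z)\<^sup>2" 0 r w] r by (simp add: circlepath_def)
    then have J: "(?J has_integral (2 * of_real pi * \<i> * (?f w)\<^sup>2)) {0..2 * pi}"
      by (subst (asm) has_contour_integral_part_circlepath_iff) auto
    have Jle: "norm (?J t) \<le> K * (cmod (?f (of_real r * cis t)))\<^sup>2" for t
    proof -
      have "r - cmod w \<le> cmod (of_real r * cis t - w)"
        using norm_triangle_ineq2[of "of_real r * cis t" w] r by (simp add: norm_mult)
      then have "r / cmod (of_real r * cis t - w) \<le> K"
        unfolding K_def using r by (intro divide_left_mono) (auto intro!: mult_pos_pos)
      then have "(r / cmod (of_real r * cis t - w)) * (cmod (?f (of_real r * cis t)))\<^sup>2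
          \<le> K * (cmod (?f (of_real r * cis t)))\<^sup>2"
        by (rule mult_right_mono) simp
      then show ?thesis
        using r by (simp add: norm_mult norm_divide norm_power mult.commute)
    qed
    have "cmod (integral {0..2 * pi} ?J)
        \<le> integral {0..2 * pi} (\<lambda>t. K * (cmod (?f (of_real r * cis t)))\<^sup>2)"
      using J Jle square_mean_integrand_integrable[OF hfun_holomorphic r(4)]
      by (intro integral_norm_bound_integral integrable_on_mult_right) (auto simp: has_integral_integrable)
    also have "integral {0..2 * pi} ?J = 2 * of_real pi * \<i> * (?f w)\<^sup>2"
      using J by (rule integral_unique)
    finally have "2 * pi * (cmod (?f w))\<^sup>2 \<le> 2 * pi * (K * square_mean ?f r)"
      by (simp add: square_mean_def norm_mult norm_power)
    then have "(cmod (?f w))\<^sup>2 \<le> K * square_mean ?f r" by simp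
    also have "\<dots> \<le> K * (norm h)\<^sup>2"
      by (intro mult_left_mono square_mean_le_norm r K)
    also have "\<dots> = (sqrt K * norm h)\<^sup>2" using K by (simp add: power_mult_distrib)
    finally show ?thesis using K by (auto intro: power2_le_imp_le)
  qed
  then show thesis by (rule that)
qed

section \<open>Dividing by the difference of a symbol and a singly covered value\<close>

text \<open>The difference of \<open>\<phi>\<close> and its value at \<open>\<sigma>\<close> is \<open>z - \<sigma>\<close> times a function without zeros, and it is
  bounded away from zero near the unit circle, so division neither creates a pole nor leaves the
  Hardy space.\<close>
lemma hardy2_divide_simple_zero:
  assumes \<phi>: "\<phi> holomorphic_on ball 0 1"
    and \<sigma>: "\<sigma> \<in> ball 0 1" "deriv \<phi> \<sigma> \<noteq> 0"
    and only: "\<And>z. z \<in> ball 0 1 \<Longrightarrow> \<phi> z = \<phi> \<sigma> \<Longrightarrow> z = \<sigma>"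
    and K: "compact K" "K \<subseteq> ball 0 1"
    and \<delta>: "\<delta> > 0" "\<And>z. z \<in> ball 0 1 - K \<Longrightarrow> \<delta> \<le> cmod (\<phi> z - \<phi> \<sigma>)"
    and h: "hfun h \<sigma> = 0"
  obtains q where "\<And>z. z \<in> ball 0 1 \<Longrightarrow> hfun h z = (\<phi> z - \<phi> \<sigma>) * hfun q z"
proof -
  define F where "F = (\<lambda>z. if z = \<sigma> then deriv (hfun h) \<sigma> else (hfun h z - hfun h \<sigma>) / (z - \<sigma>))"
  define G where "G = (\<lambda>z. if z = \<sigma> then deriv \<phi> \<sigma> else (\<phi> z - \<phi> \<sigma>) / (z - \<sigma>))"
  define q where "q = (\<lambda>z. F z / G z)"
  have G0: "G z \<noteq> 0" if "z \<in> ball 0 1" for z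
    using that \<sigma>(2) only by (auto simp: G_def)
  have F: "F holomorphic_on ball 0 1" unfolding F_def
    by (rule pole_lemma_open[OF hfun_holomorphic]) simp
  have G: "G holomorphic_on ball 0 1" unfolding G_def
    by (rule pole_lemma_open[OF \<phi>]) simp
  have q: "q holomorphic_on ball 0 1"
    unfolding q_def using G0 by (intro holomorphic_intros F G) auto
  have eq: "hfun h z = (\<phi> z - \<phi> \<sigma>) * q z" if "z \<in> ball 0 1" for z
  proof (cases "z = \<sigma>")
    case True
    then show ?thesis by (simp add: h)
  next
    case False
    then have "\<phi> z - \<phi> \<sigma> \<noteq> 0" using only that by auto
    then show ?thesis using False by (simp add: q_def F_def G_def h)
  qed
  have "compact (q ` K)"
    by (intro compact_continuous_image K holomorphic_on_imp_continuous_on holomorphic_on_subset[OF q])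
  then obtain M where M: "\<And>z. z \<in> K \<Longrightarrow> cmod (q z) \<le> M"
    by (meson bounded_iff compact_imp_bounded image_eqI)
  have qle: "(cmod (q z))\<^sup>2 \<le> (cmod (hfun h z) / \<delta>)\<^sup>2 + M\<^sup>2" if z: "z \<in> ball 0 1" for z
  proof (cases "z \<in> K")
    case True
    then have "(cmod (q z))\<^sup>2 \<le> M\<^sup>2" using M by (intro power_mono) auto
    then show ?thesis by (simp add: add_increasing)
  next
    case False
    then have "\<delta> * cmod (q z) \<le> cmod (hfun h z)"
      using \<delta>(2)[of z] z by (simp add: eq[OF z] norm_mult mult_right_mono)
    then have "cmod (q z) \<le> cmod (hfun h z) / \<delta>" using \<delta>(1) by (simp add: field_simps)
    then have "(cmod (q z))\<^sup>2 \<le> (cmod (hfun h z) / \<delta>)\<^sup>2" by (intro power_mono) auto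
    then show ?thesis by (simp add: add_increasing2)
  qed
  have "square_mean q r \<le> (norm h / \<delta>)\<^sup>2 + M\<^sup>2" if r: "r \<in> {0..<1}" for r
  proof -
    let ?S = "\<lambda>f t. (cmod (f (of_real r * cis t)))\<^sup>2"
    have int: "?S (hfun h) integrable_on {0..2 * pi}"
      by (rule square_mean_integrand_integrable[OF hfun_holomorphic r])
    have "integral {0..2 * pi} (?S q)
        \<le> integral {0..2 * pi} (\<lambda>t. (1 / \<delta>\<^sup>2) * ?S (hfun h) t + M\<^sup>2)"
      using qle[OF circle_in_ball[OF r]]
      by (intro integral_le integrable_add integrable_on_mult_right int integrable_const
          square_mean_integrand_integrable[OF q r]) (auto simp: power_divide)
    also have "\<dots> = (1 / \<delta>\<^sup>2) * integral {0..2 * pi} (?S (hfun h)) + 2 * pi * M\<^sup>2"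
      using integral_add[OF integrable_on_mult_right[OF int, of "1 / \<delta>\<^sup>2"] integrable_const_ivl]
      by simp
    finally have "square_mean q r
        \<le> 1 / (2 * pi) * ((1 / \<delta>\<^sup>2) * integral {0..2 * pi} (?S (hfun h)) + 2 * pi * M\<^sup>2)"
      unfolding square_mean_def by (rule mult_left_mono) simp
    also have "\<dots> = (1 / \<delta>\<^sup>2) * square_mean (hfun h) r + M\<^sup>2"
      unfolding square_mean_def by (simp add: field_simps)
    also have "\<dots> \<le> (1 / \<delta>\<^sup>2) * (norm h)\<^sup>2 + M\<^sup>2"
      by (intro add_right_mono mult_left_mono square_mean_le_norm r) simp
    finally show ?thesis by (simp add: power_divide)
  qed
  then obtain k where "\<And>z. z \<in> ball 0 1 \<Longrightarrow> hfun k z = q z"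
    using hardy2_exists[OF q] by blast
  then show thesis using eq by (intro that[of k]) simp
qed

text \<open>The set over a closed disc in \<open>W\<close> is the image of the disc under the inverse branch \<open>g\<close>, hence
  compact in the unit disc; outside it \<open>\<phi>\<close> keeps a positive distance from the centre.\<close>
lemma singly_covered_inverse_branch:
  assumes \<phi>: "\<phi> holomorphic_on ball 0 1" and W: "open W" "singly_covers \<phi> W"
  obtains g where "g holomorphic_on W" "g ` W \<subseteq> ball 0 1" "\<And>c. c \<in> W \<Longrightarrow> \<phi> (g c) = c"
    "\<And>c h. c \<in> W \<Longrightarrow> hfun h (g c) = 0 \<Longrightarrow>
       \<exists>q. \<forall>z\<in>ball 0 1. hfun h z = (\<phi> z - c) * hfun q z"
proof -
  obtain V where V: "V \<subseteq> ball 0 1" "inj_on \<phi> V" "\<phi> ` V = W" "{z \<in> ball 0 1. \<phi> z \<in> W} = V"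
    using W(2) unfolding singly_covers_def by blast
  have openV: "open V"
    using continuous_open_preimage[OF holomorphic_on_imp_continuous_on[OF \<phi>] open_ball W(1)] V(4)
    by (simp add: vimage_def Int_def)
  have \<phi>V: "\<phi> holomorphic_on V" using \<phi> V(1) by (rule holomorphic_on_subset)
  obtain g where g: "g holomorphic_on \<phi> ` V" "\<And>z. z \<in> V \<Longrightarrow> g (\<phi> z) = z"
    using holomorphic_has_inverse[OF \<phi>V openV V(2)] by metis
  have gW: "g c \<in> V" "\<phi> (g c) = c" if "c \<in> W" for c
    using that g(2) unfolding V(3)[symmetric] by auto
  have div: "\<exists>q. \<forall>z\<in>ball 0 1. hfun h z = (\<phi> z - c) * hfun q z"
    if c: "c \<in> W" and h: "hfun h (g c) = 0" for c h
  proof -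
    obtain \<delta> where \<delta>: "\<delta> > 0" "cball c \<delta> \<subseteq> W"
      using W(1) c open_contains_cball by blast
    let ?K = "g ` cball c \<delta>"
    have K: "compact ?K"
      by (intro compact_continuous_image holomorphic_on_imp_continuous_on compact_cball
          holomorphic_on_subset[OF g(1)]) (use \<delta> V(3) in auto)
    have far: "\<delta> \<le> cmod (\<phi> z - \<phi> (g c))" if z: "z \<in> ball 0 1 - ?K" for z
    proof (rule ccontr)
      assume "\<not> ?thesis"
      then have *: "\<phi> z \<in> cball c \<delta>"
        by (simp add: gW(2)[OF c] dist_norm norm_minus_commute)
      then have "z \<in> V" using z V(4) \<delta>(2) by auto
      then have "z \<in> ?K" using g(2)[of z] * by (metis image_eqI)
      then show False using z by simp
    qed
    have only: "z = g c" if "z \<in> ball 0 1" "\<phi> z = \<phi> (g c)" for z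
      using that c gW V(2,4) by (metis (mono_tags, lifting) inj_onD mem_Collect_eq)
    have "deriv \<phi> (g c) \<noteq> 0"
      by (rule holomorphic_injective_imp_regular[OF \<phi>V openV V(2) gW(1)[OF c]])
    moreover have "?K \<subseteq> ball 0 1" using gW(1) \<delta>(2) V(1) by blast
    ultimately obtain q where "\<And>z. z \<in> ball 0 1 \<Longrightarrow> hfun h z = (\<phi> z - \<phi> (g c)) * hfun q z"
      using hardy2_divide_simple_zero[OF \<phi> _ _ only K _ \<delta>(1) far h] gW(1)[OF c] V(1) by blast
    then show ?thesis using gW(2)[OF c] by auto
  qed
  show thesis
    by (rule that[of g]) (use g(1) V(1,3) gW div in auto)
qed

section \<open>Holomorphic quotients of modulus at most one\<close>

text \<open>The bound makes every zero of the denominator a removable singularity of the quotient, and it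
  makes the numerator vanish there too, so the product formula holds at these points as well.\<close>
lemma bounded_quotient_holomorphic:
  assumes F: "F holomorphic_on S" and E: "E holomorphic_on S" and S: "open S" "connected S"
    and nz: "\<exists>z\<in>S. E z \<noteq> 0" and le: "\<And>z. z \<in> S \<Longrightarrow> cmod (F z) \<le> cmod (E z)"
  obtains \<omega> where "\<omega> holomorphic_on S" "\<And>z. z \<in> S \<Longrightarrow> F z = \<omega> z * E z"
    "\<And>z. z \<in> S \<Longrightarrow> cmod (\<omega> z) \<le> 1"
proof -
  define Q where "Q = (\<lambda>z. F z / E z)"
  define \<omega> where "\<omega> = remove_sings Q"
  have Q1: "cmod (Q z) \<le> 1" if "z \<in> S" for z
    using le[OF that] by (cases "E z = 0") (auto simp: Q_def norm_divide field_simps)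
  have an: "\<omega> analytic_on {z}" and le1: "cmod (\<omega> z) \<le> 1" if z: "z \<in> S" for z
  proof -
    have aF: "F analytic_on {z}" and aE: "E analytic_on {z}"
      using F E S(1) z analytic_at by blast+
    have iso: "isolated_singularity_at Q z" and ness: "not_essential Q z"
      unfolding Q_def
      by (intro isolated_singularity_at_divide not_essential_divide
          isolated_singularity_at_analytic[OF aF] isolated_singularity_at_analytic[OF aE]
          not_essential_analytic[OF aF] not_essential_analytic[OF aE])+
    have ev: "\<forall>\<^sub>F x in at z. cmod (Q x) \<le> 1"
      using eventually_at_in_open'[OF S(1) z] by eventually_elim (rule Q1)
    have "\<not> is_pole Q z"
    proof
      assume "is_pole Q z"
      then have "\<forall>\<^sub>F x in at z. cmod (Q x) > 1"
        unfolding is_pole_def filterlim_at_infinity_conv_norm_at_top filterlim_at_top_dense by blast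
      with ev have "\<forall>\<^sub>F x in at z. False" by eventually_elim simp
      then show False by simp
    qed
    with ness obtain c where c: "Q \<midarrow>z\<rightarrow> c" unfolding not_essential_def by blast
    then show "\<omega> analytic_on {z}"
      unfolding \<omega>_def by (rule remove_sings_analytic_at[OF iso])
    have "cmod c \<le> 1" using tendsto_upperbound[OF tendsto_norm[OF c] ev] by simp
    then show "cmod (\<omega> z) \<le> 1" unfolding \<omega>_def using remove_sings_eqI[OF c] by simp
  qed
  have "F z = \<omega> z * E z" if z: "z \<in> S" for z
  proof (cases "E z = 0")
    case True
    then show ?thesis using le[OF z] by simp
  next
    case False
    have "Q analytic_on {z}" unfolding Q_def
      using F E S(1) z False analytic_at by (intro analytic_on_divide) blast+
    then show ?thesis using False by (simp add: \<omega>_def Q_def)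
  qed
  moreover have "\<omega> holomorphic_on S"
    using an analytic_imp_holomorphic analytic_on_analytic_at by blast
  ultimately show thesis using le1 by (intro that[of \<omega>])
qed

section \<open>Intertwined symbols factor\<close>

text \<open>At a point \<open>w\<close> with \<open>\<psi> w \<in> W\<close>, the function \<open>h\<close> minus the constant \<open>h (g (\<psi> w))\<close> is a multiple of
  \<open>\<phi> - \<psi> w\<close>, which \<open>X\<close> turns into a multiple of \<open>\<psi> - \<psi> w\<close>, and this vanishes at \<open>w\<close>. Hence \<open>X h\<close> is
  there the product of \<open>X 1\<close> and the composition of \<open>h\<close> with \<open>g \<circ> \<psi>\<close>. For \<open>h\<close> a power of \<open>z\<close> this
  identifies \<open>g \<circ> \<psi>\<close> with the meromorphic function \<open>X z / X 1\<close>, whose powers times \<open>X 1\<close> stay bounded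
  at every point, so it has modulus at most one and extends \<open>g \<circ> \<psi>\<close> to the whole disc.\<close>
theorem intertwined_imp_factorization:
  assumes \<phi>: "bounded_analytic \<phi>" and \<psi>: "bounded_analytic \<psi>"
    and W: "open W" "singly_covers \<phi> W" and meet: "\<psi> ` ball 0 1 \<inter> W \<noteq> {}"
    and tw: "toeplitz \<phi> \<propto> toeplitz \<psi>"
  obtains \<omega> where "\<omega> holomorphic_on ball 0 1" "\<omega> ` ball 0 1 \<subseteq> ball 0 1"
    "\<And>z. z \<in> ball 0 1 \<Longrightarrow> \<psi> z = \<phi> (\<omega> z)"
proof -
  let ?U = "ball (0::complex) 1"
  have hol\<phi>: "\<phi> holomorphic_on ?U" and hol\<psi>: "\<psi> holomorphic_on ?U"
    using \<phi> \<psi> by (auto simp: bounded_analytic_def)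
  obtain X where X: "bounded_linear X" "\<And>c h. X (hscale c h) = hscale c (X h)" "X \<noteq> (\<lambda>_. 0)"
    and comm: "X \<circ> toeplitz \<phi> = toeplitz \<psi> \<circ> X"
    using tw unfolding intertwined_def by blast
  have Xadd: "X (h + k) = X h + X k" for h k
    using X(1) by (simp add: linear_simps)
  obtain g where g: "g ` W \<subseteq> ?U" "\<And>c. c \<in> W \<Longrightarrow> \<phi> (g c) = c"
    and div: "\<And>c h. c \<in> W \<Longrightarrow> hfun h (g c) = 0 \<Longrightarrow>
       \<exists>q. \<forall>z\<in>?U. hfun h z = (\<phi> z - c) * hfun q z"
    using singly_covered_inverse_branch[OF hol\<phi> W] by metis
  have "\<exists>m. (\<forall>z\<in>?U. hfun m z = z ^ n) \<and> norm m \<le> 1" for n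
  proof -
    have "(\<lambda>z. z ^ n) holomorphic_on ?U" by (intro holomorphic_intros)
    moreover have "cmod (z ^ n) \<le> 1" if "z \<in> ?U" for z
      using that by (auto simp: norm_power intro!: power_le_one)
    ultimately obtain h where "\<And>z. z \<in> ?U \<Longrightarrow> hfun h z = z ^ n" "norm h \<le> 1"
      by (rule hardy2_of_bounded) metis+
    then show ?thesis by blast
  qed
  then obtain m where m: "\<And>n z. z \<in> ?U \<Longrightarrow> hfun (m n) z = z ^ n" "\<And>n. norm (m n) \<le> 1"
    by metis
  define E where "E = hfun (X (m 0))"
  define F where "F = hfun (X (m 1))"
  have E: "E holomorphic_on ?U" and F: "F holomorphic_on ?U"
    by (simp_all add: E_def F_def hfun_holomorphic)
  define D where "D = {z \<in> ?U. \<psi> z \<in> W}"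
  have D: "open D" "D \<noteq> {}" "D \<subseteq> ?U"
    using continuous_open_preimage[OF holomorphic_on_imp_continuous_on[OF hol\<psi>] open_ball W(1)] meet
    by (auto simp: D_def vimage_def Int_def)

  (* m 0 represents the constant function 1. *)
  have key: "hfun (X h) w = hfun h (g (\<psi> w)) * E w" if w: "w \<in> D" for h w
  proof -
    define c s where "c = \<psi> w" and "s = hfun h (g c)"
    have c: "c \<in> W" "g c \<in> ?U" "w \<in> ?U" using w g(1) by (auto simp: D_def c_def)
    let ?k = "h + hscale (- s) (m 0)"
    have "hfun ?k (g c) = 0"
      using c m(1)[of "g c" 0] by (simp add: hfun_plus hfun_hscale s_def)
    then obtain q where q: "\<And>z. z \<in> ?U \<Longrightarrow> hfun ?k z = (\<phi> z - c) * hfun q z"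
      using div[OF c(1)] by blast
    have "?k = toeplitz \<phi> q + hscale (- c) q"
      by (rule hardy2_eqI) (simp add: q hfun_toeplitz[OF \<phi>] hfun_hscale hfun_plus[of "toeplitz \<phi> q"] algebra_simps)
    then have "X ?k = toeplitz \<psi> (X q) + hscale (- c) (X q)"
      using fun_cong[OF comm, of q] by (simp add: Xadd X(2))
    moreover have "X ?k = X h + hscale (- s) (X (m 0))" by (simp add: Xadd X(2))
    ultimately have "hfun (X h) w + - s * E w = \<psi> w * hfun (X q) w + - c * hfun (X q) w"
      using c(3) by (metis (no_types, lifting) E_def hfun_plus hfun_hscale hfun_toeplitz[OF \<psi>])
    then show ?thesis by (simp add: c_def s_def)
  qed
  have extend: "f z = k z" if "f holomorphic_on ?U" "k holomorphic_on ?U"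
      "\<And>z. z \<in> D \<Longrightarrow> f z = k z" "z \<in> ?U" for f k z
    using analytic_continuation_open[OF D(1) open_ball D(2) connected_ball D(3) that] .

  have nz: "\<exists>z\<in>D. E z \<noteq> 0"
  proof (rule ccontr)
    assume "\<not> ?thesis"
    then have "hfun (X h) z = 0" if "z \<in> ?U" for h z
      by (intro extend[OF hfun_holomorphic _ _ that]) (auto simp: key)
    then have "X h = 0" for h by (intro hardy2_eqI) (simp add: hfun_zero)
    then show False using X(3) by auto
  qed
  (* Both sides are (g (\<psi> w)) ^ (n + 1) * E w ^ (n + 1) on D. *)
  have power: "F z ^ Suc n = hfun (X (m (Suc n))) z * E z ^ n" if z: "z \<in> ?U" for z n
  proof (rule extend[OF _ _ _ z])
    fix w assume w: "w \<in> D"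
    then have "g (\<psi> w) \<in> ?U" using g(1) by (auto simp: D_def)
    then show "F w ^ Suc n = hfun (X (m (Suc n))) w * E w ^ n"
      using m(1) by (simp add: F_def key[OF w] power_mult_distrib)
  qed (intro holomorphic_intros F E hfun_holomorphic)+
  obtain B where B: "\<And>h. norm (X h) \<le> norm h * B" "B \<ge> 0"
    using bounded_linear.nonneg_bounded[OF X(1)] by blast
  have le: "cmod (F z) \<le> cmod (E z)" if z: "z \<in> ?U" for z
  proof (cases "E z = 0")
    case True
    then show ?thesis using power[OF z, of 1] by simp
  next
    case False
    obtain C where C: "\<And>h. cmod (hfun h z) \<le> C * norm h"
      using hfun_evaluation_bounded[OF z] by blast
    have bd: "cmod (hfun (X (m n)) z) \<le> \<bar>C\<bar> * B" for n
    proof -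
      have "norm (X (m n)) \<le> B"
        using B(1)[of "m n"] mult_right_mono[OF m(2)[of n] B(2)] by simp
      then have "\<bar>C\<bar> * norm (X (m n)) \<le> \<bar>C\<bar> * B" by (intro mult_left_mono) auto
      moreover have "C * norm (X (m n)) \<le> \<bar>C\<bar> * norm (X (m n))"
        by (intro mult_right_mono) auto
      ultimately show ?thesis using C[of "X (m n)"] by simp
    qed
    show ?thesis
    proof (rule ccontr)
      assume "\<not> ?thesis"
      then have gt: "cmod (F z) > cmod (E z)" by simp
      (* Then x^n |F z| is the modulus of X (z^(n+1)) at z, which is bounded in n. *)
      define x where "x = cmod (F z) / cmod (E z)"
      have x: "x > 1" using gt False by (simp add: x_def field_simps)
      obtain n where n: "x ^ n > \<bar>C\<bar> * B / cmod (F z)" using real_arch_pow[OF x] by blast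
      have F0: "cmod (F z) > 0" using gt norm_ge_zero[of "E z"] by linarith
      have "cmod (F z) ^ Suc n = cmod (hfun (X (m (Suc n))) z) * cmod (E z) ^ n"
        using arg_cong[OF power[OF z, of n], of cmod] by (simp add: norm_mult norm_power)
      then have "x ^ n * cmod (F z) = cmod (hfun (X (m (Suc n))) z)"
        using False by (simp add: x_def power_divide field_simps)
      also have "\<dots> \<le> \<bar>C\<bar> * B" by (rule bd)
      finally show False using n F0 by (simp add: field_simps)
    qed
  qed
  obtain \<omega> where \<omega>: "\<omega> holomorphic_on ?U" "\<And>z. z \<in> ?U \<Longrightarrow> F z = \<omega> z * E z"
    and \<omega>1: "\<And>z. z \<in> ?U \<Longrightarrow> cmod (\<omega> z) \<le> 1"
    using bounded_quotient_holomorphic[OF F E open_ball connected_ball _ le] nz D(3) by blast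

  (* At zeros of X 1 the equation F z = \<omega> z * E z says nothing about \<omega> z. *)
  define D' where "D' = {z \<in> D. E z \<noteq> 0}"
  have "D' = {z \<in> D. E z \<in> - {0}}" by (simp add: D'_def)
  then have D': "open D'" "D' \<noteq> {}" "D' \<subseteq> ?U"
    using nz D(3) continuous_open_preimage[OF holomorphic_on_imp_continuous_on[OF
        holomorphic_on_subset[OF E D(3)]] D(1), of "- {0}"]
    by (auto simp: vimage_def Int_def D'_def)
  have \<omega>D: "\<omega> z = g (\<psi> z)" "\<omega> z \<in> ?U" "\<phi> (\<omega> z) = \<psi> z" if z: "z \<in> D'" for z
  proof -
    have "z \<in> D" "E z \<noteq> 0" "z \<in> ?U" "\<psi> z \<in> W" "g (\<psi> z) \<in> ?U"
      using z D(3) g(1) by (auto simp: D'_def D_def)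
    moreover from this have "F z = g (\<psi> z) * E z"
      using m(1) by (simp add: F_def key)
    ultimately show "\<omega> z = g (\<psi> z)" using \<omega>(2)[of z] by simp
    with \<open>g (\<psi> z) \<in> ?U\<close> \<open>\<psi> z \<in> W\<close> show "\<omega> z \<in> ?U" "\<phi> (\<omega> z) = \<psi> z" using g(2) by auto
  qed
  have \<omega>U: "\<omega> z \<in> ?U" if z: "z \<in> ?U" for z
  proof (rule ccontr)
    assume "\<omega> z \<notin> ?U"
    then have eq1: "cmod (\<omega> z) = 1" using \<omega>1[OF z] by simp
    have "\<omega> constant_on ?U"
      by (rule maximum_modulus_principle[OF \<omega>(1) _ _ _ order_refl z]) (auto simp: eq1 \<omega>1)
    then obtain c where c: "\<forall>y\<in>?U. \<omega> y = c" unfolding constant_on_def ..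
    obtain y where "y \<in> D'" using D'(2) by blast
    then have "y \<in> ?U" using D'(3) by (rule subsetD[rotated])
    then have "\<omega> z = \<omega> y" using bspec[OF c z] bspec[OF c] by (simp only:)
    then show False using \<omega>D(2)[OF \<open>y \<in> D'\<close>] eq1 by simp
  qed
  have "\<phi> \<circ> \<omega> holomorphic_on ?U"
    by (rule holomorphic_on_compose_gen[OF \<omega>(1) hol\<phi>]) (use \<omega>U in auto)
  then have "\<psi> z = (\<phi> \<circ> \<omega>) z" if "z \<in> ?U" for z
    by (rule analytic_continuation_open[OF D'(1) open_ball D'(2) connected_ball D'(3) hol\<psi> _ _ that])
      (simp add: \<omega>D(3))
  then show thesis using \<omega>(1) \<omega>U by (intro that[of \<omega>]) auto
qed

section \<open>A zero that exhausts the valence\<close>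

text \<open>The zero at \<open>z0\<close> uses up all \<open>p\<close> multiplicities that the value \<open>\<phi> z0\<close> can have; finiteness of the
  fibre keeps \<open>\<phi>\<close> from being constant, so any other preimage would add a positive order.\<close>
lemma valent_full_order:
  assumes \<phi>: "\<phi> holomorphic_on ball 0 1" and v: "valent p \<phi>" and p: "p > 1"
    and z0: "z0 \<in> ball 0 1" "zorder (\<lambda>z. \<phi> z - \<phi> z0) z0 = int p"
  shows "\<And>z. z \<in> ball 0 1 \<Longrightarrow> \<phi> z = \<phi> z0 \<Longrightarrow> z = z0"
    and "deriv \<phi> z0 = 0"
proof -
  define f where "f = (\<lambda>z. \<phi> z - \<phi> z0)"
  define S where "S = {z \<in> ball 0 1. \<phi> z = \<phi> z0}"
  have f: "f holomorphic_on ball 0 1" unfolding f_def by (intro holomorphic_intros \<phi>)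
  have fin: "finite S" and tt: "times_taken \<phi> (\<phi> z0) \<le> p"
    using v by (auto simp: valent_def S_def)
  have "\<exists>w\<in>ball 0 1. f w \<noteq> 0"
  proof (rule ccontr)
    assume "\<not> ?thesis"
    then have "S = ball 0 1" by (auto simp: S_def f_def)
    then show False using fin uncountable_ball[of 1 "0::complex"] countable_finite by auto
  qed
  then have pos: "zorder f z > 0" if "z \<in> S" for z
    using zorder_exist_zero[OF f open_ball connected_ball, of z] that by (auto simp: S_def f_def)
  show "z = z0" if "z \<in> ball 0 1" "\<phi> z = \<phi> z0" for z
  proof (rule ccontr)
    assume "z \<noteq> z0"
    have zS: "z \<in> S" "z0 \<in> S" using that z0(1) by (auto simp: S_def)
    have "nat (zorder f z) + nat (zorder f z0) = (\<Sum>y\<in>{z, z0}. nat (zorder f y))"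
      using \<open>z \<noteq> z0\<close> by simp
    also have "\<dots> \<le> (\<Sum>y\<in>S. nat (zorder f y))"
      by (rule sum_mono2[OF fin]) (use zS in auto)
    also have "\<dots> = times_taken \<phi> (\<phi> z0)" by (simp add: times_taken_def S_def f_def)
    finally show False using tt pos[OF zS(1)] z0(2) by (simp add: f_def)
  qed
  show "deriv \<phi> z0 = 0"
  proof (rule ccontr)
    assume "deriv \<phi> z0 \<noteq> 0"
    moreover have "deriv f z0 = deriv \<phi> z0"
      unfolding f_def using holomorphic_on_imp_differentiable_at[OF \<phi> open_ball z0(1)] by simp
    ultimately have "zorder f z0 = 1"
      by (intro zorder_zero_eqI[OF f open_ball z0(1)]) (auto simp: f_def)
    then show False using z0(2) p by (simp add: f_def)
  qed
qed

section \<open>Maps of the disc into a domain through two given points\<close>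

text \<open>The real and imaginary parts are real polynomials, which make sense for complex arguments.\<close>
lemma polynomial_path_holomorphic_extension:
  assumes "polynomial_function (g :: real \<Rightarrow> complex)"
  obtains G where "G holomorphic_on UNIV" "\<And>t. G (of_real t) = g t"
proof -
  have "real_polynomial_function (Re \<circ> g)" "real_polynomial_function (Im \<circ> g)"
    using assms bounded_linear_Re bounded_linear_Im by (auto simp: polynomial_function_def)
  then obtain a n b k where ab: "Re \<circ> g = (\<lambda>x. \<Sum>i\<le>n. a i * x ^ i)" "Im \<circ> g = (\<lambda>x. \<Sum>i\<le>k. b i * x ^ i)"
    unfolding real_polynomial_function_iff_sum by blast
  define G where "G = (\<lambda>z::complex. (\<Sum>i\<le>n. of_real (a i) * z ^ i) + \<i> * (\<Sum>i\<le>k. of_real (b i) * z ^ i))"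
  have "G (of_real t) = g t" for t
  proof -
    have "G (of_real t) = of_real (Re (g t)) + \<i> * of_real (Im (g t))"
      using fun_cong[OF ab(1), of t] fun_cong[OF ab(2), of t] by (simp add: G_def)
    then show ?thesis by (simp add: complex_eq_iff)
  qed
  moreover have "G holomorphic_on UNIV" unfolding G_def by (intro holomorphic_intros)
  ultimately show thesis by (rule that[rotated])
qed

text \<open>A polynomial arc from \<open>a\<close> to \<open>b\<close> extends to an entire function. After a small perturbation that
  vanishes at both ends its derivative at the initial point is nonzero, and it still maps a thin
  convex neighbourhood of the parameter interval into the domain. A Riemann map from the disc onto
  this neighbourhood supplies the rest.\<close>
lemma disc_map_through_two_points:
  assumes D: "open D" "connected D" "a \<in> D" "b \<in> D"
  obtains \<psi> u v where "\<psi> holomorphic_on ball 0 1" "\<psi> ` ball 0 1 \<subseteq> D"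
    "u \<in> ball 0 1" "\<psi> u = a" "deriv \<psi> u \<noteq> 0" "v \<in> ball 0 1" "\<psi> v = (b :: complex)"
proof -
  obtain g where g: "polynomial_function g" "path_image g \<subseteq> D" "pathstart g = a" "pathfinish g = b"
    using connected_open_polynomial_connected[OF D] by blast
  obtain G where G: "G holomorphic_on UNIV" "\<And>t. G (of_real t) = g t"
    using polynomial_path_holomorphic_extension[OF g(1)] by blast
  have "compact (path_image g)"
    using g(1) by (intro compact_path_image) (simp add: path_def continuous_on_polymonial_function)
  then obtain \<epsilon> where \<epsilon>: "\<epsilon> > 0" "(\<Union>x\<in>path_image g. cball x \<epsilon>) \<subseteq> D"
    using compact_subset_open_imp_cball_epsilon_subset[OF _ D(1) g(2)] by blast
  (* The perturbation has derivative \<tau> at 0 and is at most \<tau> on [0,1]. *)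
  define \<tau> where "\<tau> = (if deriv G 0 = 0 then \<epsilon> else 0)"
  define H where "H = (\<lambda>z. G z + of_real \<tau> * (z * (1 - z)))"
  have H: "H holomorphic_on UNIV" unfolding H_def by (intro holomorphic_intros G)
  have H0: "H 0 = a" and H1: "H 1 = b"
    using G(2)[of 0] G(2)[of 1] g(3,4) by (auto simp: H_def pathstart_def pathfinish_def)
  have "(G has_field_derivative deriv G 0) (at 0)"
    using G(1) holomorphic_derivI by blast
  then have "(H has_field_derivative deriv G 0 + of_real \<tau>) (at 0)"
    unfolding H_def by (auto intro!: derivative_eq_intros)
  then have "deriv H 0 = deriv G 0 + of_real \<tau>" by (rule DERIV_imp_deriv)
  then have dH: "deriv H 0 \<noteq> 0" using \<epsilon>(1) by (simp add: \<tau>_def)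
  define I where "I = closed_segment (0::complex) 1"
  have HI: "H z \<in> D" if z: "z \<in> I" for z
  proof -
    obtain t where t: "z = of_real t" "0 \<le> t" "t \<le> 1"
      using z by (auto simp: I_def in_segment scaleR_conv_of_real)
    have "t * (1 - t) \<le> 1 * 1" using t by (intro mult_mono) auto
    then have "\<bar>\<tau>\<bar> * (t * (1 - t)) \<le> \<epsilon> * 1"
      using t \<epsilon>(1) by (intro mult_mono) (auto simp: \<tau>_def)
    moreover have "H z - g t = of_real (\<tau> * (t * (1 - t)))"
      using G(2)[of t] by (simp add: H_def t(1))
    moreover have "\<bar>\<tau> * (t * (1 - t))\<bar> = \<bar>\<tau>\<bar> * (t * (1 - t))" using t by (simp add: abs_mult)
    ultimately have "cmod (H z - g t) \<le> \<epsilon>" by (simp only: norm_of_real mult_1_right)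
    then have "dist (g t) (H z) \<le> \<epsilon>" by (simp add: dist_norm norm_minus_commute)
    moreover have "g t \<in> path_image g" using t by (auto simp: path_image_def)
    ultimately show ?thesis using \<epsilon>(2) by (auto simp: subset_iff)
  qed
  have "open {z \<in> UNIV. H z \<in> D}"
    using continuous_open_preimage[OF holomorphic_on_imp_continuous_on[OF H] open_UNIV D(1)]
    by (simp add: vimage_def)
  then obtain \<eta> where \<eta>: "\<eta> > 0" "(\<Union>x\<in>I. ball x \<eta>) \<subseteq> {z \<in> UNIV. H z \<in> D}"
    using compact_subset_open_imp_ball_epsilon_subset[of I "{z \<in> UNIV. H z \<in> D}"] HI
    by (auto simp: I_def)
  define N where "N = (\<Union>x\<in>I. ball x \<eta>)"
  have ball_eq: "ball x \<eta> = (\<Union>y\<in>ball 0 \<eta>. {x + y})" for x :: complex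
    by (simp only: UNION_singleton_eq_range image_add_ball add_0_left)
  have N_eq: "N = (\<Union>x\<in>I. \<Union>y\<in>ball 0 \<eta>. {x + y})"
    unfolding N_def by (rule SUP_cong[OF refl ball_eq])
  have convN: "convex N"
    unfolding N_eq by (intro convex_sums) (simp_all add: I_def)
  have openN: "open N" by (auto simp: N_def)
  have "bounded N"
  proof -
    have "bounded (\<Union>x\<in>I. \<Union>y\<in>ball 0 \<eta>. {x + y})"
      by (rule bounded_sums) (simp_all add: I_def compact_imp_bounded)
    then show ?thesis by (simp only: N_eq)
  qed
  then have "N \<noteq> UNIV" using not_bounded_UNIV by metis
  have "0 \<in> I" "1 \<in> I" by (simp_all add: I_def)
  moreover have "0 \<in> ball 0 \<eta>" "1 \<in> ball 1 \<eta>" using \<eta>(1) by simp_all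
  ultimately have N01: "0 \<in> N" "1 \<in> N" unfolding N_def by blast+
  obtain f R where f: "\<And>z. z \<in> N \<Longrightarrow> f z \<in> ball 0 1 \<and> R (f z) = z"
    and R: "R holomorphic_on ball 0 1" "\<And>z. z \<in> ball 0 1 \<Longrightarrow> R z \<in> N \<and> f (R z) = z"
    using Riemann_mapping_theorem[of N] openN convex_imp_simply_connected[OF convN] N01 \<open>N \<noteq> UNIV\<close>
    by blast
  have "inj_on R (ball 0 1)" using R(2) by (metis inj_onI)
  then have dR: "deriv R (f 0) \<noteq> 0"
    using f[OF N01(1)] by (intro holomorphic_injective_imp_regular[OF R(1) open_ball]) auto
  show thesis
  proof (rule that[of "H \<circ> R" "f 0" "f 1"])
    show "H \<circ> R holomorphic_on ball 0 1"
      by (rule holomorphic_on_compose_gen[OF R(1) H]) simp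
    show "(H \<circ> R) ` ball 0 1 \<subseteq> D" using R(2) \<eta>(2) by (fastforce simp: N_def)
    show "f 0 \<in> ball 0 1" "f 1 \<in> ball 0 1" "(H \<circ> R) (f 0) = a" "(H \<circ> R) (f 1) = b"
      using f N01 H0 H1 by auto
    have "deriv (H \<circ> R) (f 0) = deriv H (R (f 0)) * deriv R (f 0)"
      by (rule deriv_chain)
        (use f[OF N01(1)] H R(1) holomorphic_on_imp_differentiable_at in \<open>blast+\<close>)
    then show "deriv (H \<circ> R) (f 0) \<noteq> 0" using f[OF N01(1)] dH dR by simp
  qed
qed

section \<open>Symbols that are not intertwined\<close>

theorem corollary4p5:
  fixes p :: nat and \<phi> :: "complex \<Rightarrow> complex" and z\<^sub>0 :: complex and W :: "complex set"
  assumes "p > 1"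
    and "bounded_analytic \<phi>"
    and "valent p \<phi>"
    and "z\<^sub>0 \<in> ball 0 1" and "zorder (\<lambda>z. \<phi> z - \<phi> z\<^sub>0) z\<^sub>0 = int p"
    and "open W" and "W \<noteq> {}" and "W \<subseteq> \<phi> ` ball 0 1" and "singly_covers \<phi> W"
  shows "\<exists>\<psi>. bounded_analytic \<psi> \<and> \<psi> ` ball 0 1 \<subseteq> \<phi> ` ball 0 1 \<and>
           \<not> (toeplitz \<phi> \<propto> toeplitz \<psi>)"
proof -
  have \<phi>: "\<phi> holomorphic_on ball 0 1" "bounded (\<phi> ` ball 0 1)"
    using assms(2) by (auto simp: bounded_analytic_def)
  have uniq: "\<And>z. z \<in> ball 0 1 \<Longrightarrow> \<phi> z = \<phi> z\<^sub>0 \<Longrightarrow> z = z\<^sub>0" and crit: "deriv \<phi> z\<^sub>0 = 0"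
    using valent_full_order[OF \<phi>(1) assms(3,1,4,5)] by blast+
  have "\<not> \<phi> constant_on ball 0 1"
  proof
    assume "\<phi> constant_on ball 0 1"
    then have "\<phi> z = \<phi> z\<^sub>0" if "z \<in> ball 0 1" for z
      using that assms(4) unfolding constant_on_def by metis
    then have "ball 0 1 \<subseteq> {z\<^sub>0}" using uniq by auto
    then have "countable (ball (0::complex) 1)" using countable_subset by blast
    then show False using uncountable_ball[of 1 "0::complex"] by simp
  qed
  then have "open (\<phi> ` ball 0 1)"
    by (intro open_mapping_thm[OF \<phi>(1)]) auto
  moreover have "connected (\<phi> ` ball 0 1)"
    by (intro connected_continuous_image holomorphic_on_imp_continuous_on \<phi> connected_ball)
  moreover obtain b where b: "b \<in> W" "b \<in> \<phi> ` ball 0 1" using assms(7,8) by blast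
  ultimately obtain \<psi> u v where \<psi>: "\<psi> holomorphic_on ball 0 1" "\<psi> ` ball 0 1 \<subseteq> \<phi> ` ball 0 1"
    and u: "u \<in> ball 0 1" "\<psi> u = \<phi> z\<^sub>0" "deriv \<psi> u \<noteq> 0" and v: "v \<in> ball 0 1" "\<psi> v = b"
    using disc_map_through_two_points[of "\<phi> ` ball 0 1" "\<phi> z\<^sub>0" b] assms(4) by blast
  have b\<psi>: "bounded_analytic \<psi>"
    using \<psi> \<phi>(2) bounded_subset by (auto simp: bounded_analytic_def)
  have "\<not> toeplitz \<phi> \<propto> toeplitz \<psi>"
  proof
    assume tw: "toeplitz \<phi> \<propto> toeplitz \<psi>"
    have "\<psi> ` ball 0 1 \<inter> W \<noteq> {}" using v b(1) by blast
    then obtain \<omega> where \<omega>: "\<omega> holomorphic_on ball 0 1" "\<omega> ` ball 0 1 \<subseteq> ball 0 1"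
      "\<And>z. z \<in> ball 0 1 \<Longrightarrow> \<psi> z = \<phi> (\<omega> z)"
      using intertwined_imp_factorization[OF assms(2) b\<psi> assms(6,9) _ tw] by blast
    have \<omega>u: "\<omega> u = z\<^sub>0" using uniq \<omega>(2,3) u by (metis image_subset_iff)
    have "deriv \<psi> u = deriv (\<phi> \<circ> \<omega>) u"
      using eventually_nhds_in_open[OF open_ball u(1)]
      by (intro deriv_cong_ev) (auto elim!: eventually_mono simp: \<omega>(3))
    also have "\<dots> = deriv \<phi> (\<omega> u) * deriv \<omega> u"
      using \<omega>u assms(4) u(1) holomorphic_on_imp_differentiable_at[OF \<phi>(1) open_ball]
        holomorphic_on_imp_differentiable_at[OF \<omega>(1) open_ball]
      by (intro deriv_chain) auto
    finally show False using u(3) crit \<omega>u by simp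
  qed
  then show ?thesis using b\<psi> \<psi>(2) by blast
qed

end
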